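(* Let $G=(V,E)$ be a finite simple graph and let $1\le k\le |V|/2$. Then \[ \lambda_1(L(F_k(G)))\le |E|+4k-2. \] Moreover, if $G$ is bipartite, then $\lambda_1(L(F_k(G)))\le |E|+2k-1$.
   Context: For a graph $G=(V,E)$ and $0\le k\le |V|$, the $k$-th token graph $F_k(G)$ is the graph with vertex set $\binom{V}{k}=\{\sigma\subset V:|\sigma|=k\}$ in which $\sigma,\tau$ are adjacent iff the symmetric difference $\sigma\triangle\tau$ is an edge of $G$. The Laplacian matrix $L(H)$ of a graph $H$ has diagonal entries equal to the degrees, entry $-1$ for adjacent pairs, and $0$ otherwise; $\lambda_1$ denotes the largest eigenvalue. *)

theory Defs
  imports Complex_Main "Jordan_Normal_Form.Spectral_Radius"
begin

text \<open>A graph is given by its vertex set and its set of edges, an edge being the two-element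
  set of its end points.\<close>

definition finite_simple_graph :: "'v set \<Rightarrow> 'v set set \<Rightarrow> bool" where
  "finite_simple_graph V E \<longleftrightarrow> finite V \<and> (\<forall>e\<in>E. e \<subseteq> V \<and> card e = 2)"

definition bipartite_graph :: "'v set \<Rightarrow> 'v set set \<Rightarrow> bool" where
  "bipartite_graph V E \<longleftrightarrow>
     (\<exists>A B. A \<union> B = V \<and> A \<inter> B = {} \<and> (\<forall>e\<in>E. \<exists>a\<in>A. \<exists>b\<in>B. e = {a, b}))"

definition token_verts :: "nat \<Rightarrow> 'v set \<Rightarrow> 'v set set" where
  "token_verts k V = {\<sigma>. \<sigma> \<subseteq> V \<and> card \<sigma> = k}"

definition token_edges :: "nat \<Rightarrow> 'v set \<Rightarrow> 'v set set \<Rightarrow> 'v set set set" where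
  "token_edges k V E =
     {{\<sigma>, \<tau>} | \<sigma> \<tau>. \<sigma> \<in> token_verts k V \<and> \<tau> \<in> token_verts k V \<and> sym_diff \<sigma> \<tau> \<in> E}"

definition graph_degree :: "'v set set \<Rightarrow> 'v \<Rightarrow> nat" where
  "graph_degree E v = card {e \<in> E. v \<in> e}"

definition laplacian_entry :: "'v set set \<Rightarrow> 'v \<Rightarrow> 'v \<Rightarrow> real" where
  "laplacian_entry E u v =
     (if u = v then real (graph_degree E u) else if {u, v} \<in> E then - 1 else 0)"

text \<open>Matrices of type \<^typ>\<open>real mat\<close> are indexed by natural numbers, so rows and columns are
  labelled through an arbitrary enumeration of the vertex set. By \<open>eigenvalue_laplacian_iff\<close>
  below the spectrum does not depend on this choice.\<close>

definition vertex_list :: "'v set \<Rightarrow> 'v list" where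
  "vertex_list V = (SOME vs. distinct vs \<and> set vs = V)"

definition laplacian :: "'v set \<Rightarrow> 'v set set \<Rightarrow> real mat" where
  "laplacian V E = mat (card V) (card V)
     (\<lambda>(i, j). laplacian_entry E (vertex_list V ! i) (vertex_list V ! j))"

text \<open>The spectrum of a Laplacian is
  finite and, if there are vertices, nonempty (see \<open>finite_spectrum_laplacian\<close> and
  \<open>spectrum_laplacian_nonempty\<close>), so that \<^const>\<open>Max\<close> is meaningful.\<close>

definition largest_eigenvalue :: "real mat \<Rightarrow> real" where
  "largest_eigenvalue A = Max (spectrum A)"

lemma vertex_list:
  assumes "finite V"
  shows "distinct (vertex_list V)" "set (vertex_list V) = V" "length (vertex_list V) = card V"
proof -
  have "distinct (vertex_list V) \<and> set (vertex_list V) = V"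
    unfolding vertex_list_def
    by (rule someI_ex) (use finite_distinct_list[OF assms] in blast)
  then show "distinct (vertex_list V)" "set (vertex_list V) = V"
    "length (vertex_list V) = card V"
    using distinct_card by fastforce+
qed

lemma laplacian_carrier: "laplacian V E \<in> carrier_mat (card V) (card V)"
  by (simp add: laplacian_def)

lemma eigenvalue_laplacian_iff:
  assumes V: "finite V"
  shows "eigenvalue (laplacian V E) l \<longleftrightarrow>
    (\<exists>x. (\<exists>v\<in>V. x v \<noteq> 0) \<and> (\<forall>u\<in>V. (\<Sum>v\<in>V. laplacian_entry E u v * x v) = l * x u))"
    (is "?L \<longleftrightarrow> ?R")
proof -
  let ?n = "card V" and ?f = "(!) (vertex_list V)"
  note vl = vertex_list[OF V]
  have bij: "bij_betw ?f {0..<?n} V"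
    using bij_betw_nth[OF vl(1)] vl by (metis atLeast0LessThan)
  have row: "(laplacian V E *\<^sub>v w) $ i = (\<Sum>v\<in>V. laplacian_entry E (?f i) v * x v)"
    if "i < ?n" "w \<in> carrier_vec ?n" "\<And>j. j < ?n \<Longrightarrow> w $ j = x (?f j)" for i w x
  proof -
    have "(laplacian V E *\<^sub>v w) $ i = (\<Sum>j\<in>{0..<?n}. laplacian_entry E (?f i) (?f j) * x (?f j))"
      using that by (auto simp: laplacian_def scalar_prod_def intro!: sum.cong)
    then show ?thesis
      using sum.reindex_bij_betw[OF bij, of "\<lambda>v. laplacian_entry E (?f i) v * x v"] by simp
  qed
  have inV: "?f i \<in> V" if "i < ?n" for i
    using bij that by (auto simp: bij_betw_def)
  have ex: "\<exists>i<?n. v = ?f i" if "v \<in> V" for v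
    using bij that by (force simp: bij_betw_def)
  show ?thesis
  proof
    assume ?L
    then obtain w where w: "w \<in> carrier_vec ?n" "w \<noteq> 0\<^sub>v ?n" "laplacian V E *\<^sub>v w = l \<cdot>\<^sub>v w"
      using laplacian_carrier[of V E] by (auto simp: eigenvalue_def eigenvector_def)
    define x where "x v = w $ (the_inv_into {0..<?n} ?f v)" for v
    have x: "w $ j = x (?f j)" if "j < ?n" for j
      using bij that by (simp add: x_def the_inv_into_f_f bij_betw_def)
    obtain i where "i < ?n" "w $ i \<noteq> 0"
      using w by (metis carrier_vecD eq_vecI index_zero_vec)
    then have "\<exists>v\<in>V. x v \<noteq> 0" using x inV by metis
    moreover have "(\<Sum>v\<in>V. laplacian_entry E u v * x v) = l * x u" if "u \<in> V" for u
    proof -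
      obtain i where i: "i < ?n" "u = ?f i" using ex \<open>u \<in> V\<close> by blast
      have "(laplacian V E *\<^sub>v w) $ i = l * w $ i" using w i by simp
      then show ?thesis using row[OF i(1) w(1) x] x i by simp
    qed
    ultimately show ?R by blast
  next
    assume ?R
    then obtain x where x: "\<exists>v\<in>V. x v \<noteq> 0"
      "\<And>u. u \<in> V \<Longrightarrow> (\<Sum>v\<in>V. laplacian_entry E u v * x v) = l * x u" by blast
    define w where "w = vec ?n (\<lambda>i. x (?f i))"
    have w: "w \<in> carrier_vec ?n" "\<And>j. j < ?n \<Longrightarrow> w $ j = x (?f j)" by (auto simp: w_def)
    have "w \<noteq> 0\<^sub>v ?n" using x(1) ex w(2) by (metis index_zero_vec(1))
    moreover have "laplacian V E *\<^sub>v w = l \<cdot>\<^sub>v w"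
    proof (rule eq_vecI)
      fix i assume "i < dim_vec (l \<cdot>\<^sub>v w)"
      then have i: "i < ?n" using w by simp
      show "(laplacian V E *\<^sub>v w) $ i = (l \<cdot>\<^sub>v w) $ i"
        using row[OF i w] x(2)[OF inV[OF i]] w i by simp
    qed (use w laplacian_carrier[of V E] in auto)
    ultimately show ?L
      using w laplacian_carrier[of V E] by (auto simp: eigenvalue_def eigenvector_def)
  qed
qed

lemma finite_spectrum_laplacian: "finite (spectrum (laplacian V E))"
  by (rule card_finite_spectrum(1)[OF laplacian_carrier])

lemma spectrum_laplacian_nonempty:
  assumes V: "finite V" "V \<noteq> {}"
  shows "spectrum (laplacian V E) \<noteq> {}"
proof -
  let ?n = "card V" and ?A = "laplacian V E"
  let ?C = "map_mat complex_of_real ?A"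
  have n: "?n > 0" using V by (simp add: card_gt_0_iff)
  have A: "?A \<in> carrier_mat ?n ?n" and C: "?C \<in> carrier_mat ?n ?n"
    using laplacian_carrier[of V E] by auto
  have sym: "?A $$ (i, j) = ?A $$ (j, i)" if "i < ?n" "j < ?n" for i j
    using that by (auto simp: laplacian_def laplacian_entry_def insert_commute)
  obtain z where "eigenvalue ?C z"
    using spectrum_non_empty[OF C n] by (auto simp: spectrum_def)
  then obtain w where w: "w \<in> carrier_vec ?n" "w \<noteq> 0\<^sub>v ?n" "?C *\<^sub>v w = z \<cdot>\<^sub>v w"
    using C by (auto simp: eigenvalue_def eigenvector_def)
  have eq: "(\<Sum>j\<in>{0..<?n}. complex_of_real (?A $$ (i, j)) * w $ j) = z * w $ i" if "i < ?n" for i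
  proof -
    have "(?C *\<^sub>v w) $ i = (\<Sum>j\<in>{0..<?n}. complex_of_real (?A $$ (i, j)) * w $ j)"
      using that A w(1) by (auto simp: scalar_prod_def intro!: sum.cong)
    then show ?thesis using w that by simp
  qed
  let ?S = "\<Sum>i\<in>{0..<?n}. \<Sum>j\<in>{0..<?n}. cnj (w $ i) * complex_of_real (?A $$ (i, j)) * w $ j"
  define N where "N = (\<Sum>i\<in>{0..<?n}. (cmod (w $ i))\<^sup>2)"
  have "?S = (\<Sum>i\<in>{0..<?n}. cnj (w $ i) * (z * w $ i))"
    by (rule sum.cong) (simp_all add: eq[symmetric] sum_distrib_left mult.assoc)
  also have "\<dots> = z * complex_of_real N"
    unfolding N_def of_real_sum sum_distrib_left
    by (rule sum.cong) (simp_all add: complex_norm_square mult.commute mult.left_commute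
          del: of_real_power)
  finally have S: "?S = z * complex_of_real N" .
  have "cnj ?S = (\<Sum>i\<in>{0..<?n}. \<Sum>j\<in>{0..<?n}. w $ i * complex_of_real (?A $$ (i, j)) * cnj (w $ j))"
    by simp
  also have "\<dots> = (\<Sum>j\<in>{0..<?n}. \<Sum>i\<in>{0..<?n}. w $ i * complex_of_real (?A $$ (i, j)) * cnj (w $ j))"
    by (rule sum.swap)
  also have "\<dots> = ?S"
    by (intro sum.cong refl) (simp add: sym mult.commute mult.left_commute)
  finally have "cnj ?S = ?S" .
  then have "cnj z * complex_of_real N = z * complex_of_real N" unfolding S by simp
  moreover have "N \<noteq> 0"
  proof -
    obtain i where i: "i < ?n" "w $ i \<noteq> 0"
      using w by (metis carrier_vecD eq_vecI index_zero_vec)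
    have "0 < (cmod (w $ i))\<^sup>2" using i by simp
    also have "\<dots> \<le> N" unfolding N_def by (rule member_le_sum) (use i in auto)
    finally show ?thesis by simp
  qed
  ultimately have "cnj z = z" by simp
  then obtain r where r: "z = complex_of_real r"
    using Reals_cnj_iff by (metis Reals_cases)
  have "poly (char_poly ?C) z = 0"
    using \<open>eigenvalue ?C z\<close> eigenvalue_root_char_poly[OF C] by simp
  then have "poly (char_poly ?A) r = 0"
    by (simp add: r of_real_hom.char_poly_hom[OF A])
  then show ?thesis
    using eigenvalue_root_char_poly[OF A] by (auto simp: spectrum_def)
qed

end

theory Submission
  imports Defs
begin

text \<open>The Laplacian form of the token graph is the sum over \<open>e \<in> E\<close> of the energies across \<open>e\<close>,
  so the largest eigenvalue is subadditive in the edge set. By the Anderson--Morley bound (the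
  largest degree sum along an edge), a star with \<open>m\<close> edges contributes at most \<open>m + 1\<close>, and a
  matching contributes at most \<open>2 * k\<close>, since \<open>k\<close> tokens meet at most \<open>k\<close> of its edges. A matching
  of size at least \<open>2 * k\<close> can therefore be removed at a cost of at most one per edge. Once all
  matchings have at most \<open>2 * k - 1\<close> edges, some vertex cover has at most \<open>4 * k - 2\<close> vertices, or
  \<open>2 * k - 1\<close> in the bipartite case by Koenig's theorem; it partitions the remaining edges into that
  many stars, each costing one more than its number of edges.\<close>

subsection \<open>Matchings and vertex covers\<close>

text \<open>Finiteness of \<open>C\<close> is demanded because \<open>card\<close> of an infinite
  set is 0, so an infinite cover would pass as small.\<close>

definition vertex_cover :: "'v set \<Rightarrow> 'v set set \<Rightarrow> bool" where
  "vertex_cover C E \<longleftrightarrow> finite C \<and> (\<forall>e\<in>E. e \<inter> C \<noteq> {})"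

text \<open>A matching is encoded as a pairwise disjoint set of edges. For an inclusion-maximal one,
  the end points \<open>\<Union>M\<close> cover \<open>E\<close>, since an edge missing them could
  be added to \<open>M\<close>.\<close>

lemma matching_with_small_vertex_cover:
  assumes "finite E" and E2: "\<And>e. e \<in> E \<Longrightarrow> card e = 2"
  obtains M C where "M \<subseteq> E" "disjoint M" "vertex_cover C E" "card C \<le> 2 * card M"
proof -
  have "finite {M. M \<subseteq> E \<and> disjoint M}" "{} \<in> {M. M \<subseteq> E \<and> disjoint M}"
    using \<open>finite E\<close> by auto
  from finite_has_maximal2[OF this]
  obtain M where M: "M \<subseteq> E" "disjoint M"
    and max: "\<And>M'. M' \<subseteq> E \<Longrightarrow> disjoint M' \<Longrightarrow> M \<subseteq> M' \<Longrightarrow> M = M'"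
    by auto
  have fin: "finite M" using M \<open>finite E\<close> finite_subset by blast
  have finM: "finite e" if "e \<in> M" for e
    using E2 M that by (metis card.infinite subsetD zero_neq_numeral)
  have "e \<inter> \<Union>M \<noteq> {}" if "e \<in> E" for e
  proof
    assume e: "e \<inter> \<Union>M = {}"
    have "disjoint (insert e M)"
      using M(2) e by (auto simp: pairwise_insert disjnt_def)
    then have "M = insert e M" using max[of "insert e M"] M that by auto
    then have "e \<in> M" by blast
    then have "e = {}" using e by blast
    then show False using E2[OF that] by simp
  qed
  then have "vertex_cover (\<Union>M) E"
    using fin finM by (auto simp: vertex_cover_def)
  moreover have "card (\<Union>M) \<le> 2 * card M"
  proof -
    have "sum card M = (\<Sum>_\<in>M. 2)" by (rule sum.cong) (use E2 M in auto)
    then show ?thesis using card_Union_le_sum_card[of M] by simp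
  qed
  ultimately show ?thesis using that M by blast
qed

text \<open>Mixing the covers of \<open>E - {e}\<close> and \<open>E - {f}\<close> (union on one side, intersection on the other)
  would give a cover of \<open>E\<close> that is too small.\<close>

lemma critical_bipartite_no_shared_vertex:
  assumes AB: "A \<inter> B = {}" and E: "\<forall>e\<in>E. \<exists>a\<in>A. \<exists>b\<in>B. e = {a, b}"
    and t: "\<And>C. vertex_cover C E \<Longrightarrow> t \<le> card C"
    and crit: "\<And>e. e \<in> E \<Longrightarrow> \<exists>C. vertex_cover C (E - {e}) \<and> card C < t"
    and ef: "e \<in> E" "f \<in> E" "e \<noteq> f" and x: "x \<in> A" "x \<in> e" "x \<in> f"
  shows False
proof -
  obtain S where S: "vertex_cover S (E - {e})" "card S < t" using crit ef by blast
  obtain T where T: "vertex_cover T (E - {f})" "card T < t" using crit ef by blast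
  have other: "\<exists>y\<in>B. g = {x, y}" if g: "g \<in> E" "x \<in> g" for g
  proof -
    obtain a b where "a \<in> A" "b \<in> B" "g = {a, b}" using E g(1) by blast
    then show ?thesis using g(2) x(1) AB by auto
  qed
  obtain y where y: "e = {x, y}" "y \<in> B" using other ef x by blast
  obtain z where z: "f = {x, z}" "z \<in> B" using other ef x by blast
  have "e \<inter> S = {}"
  proof (rule ccontr)
    assume "e \<inter> S \<noteq> {}"
    then have "vertex_cover S E" using S by (auto simp: vertex_cover_def)
    then show False using t S by fastforce
  qed
  have "f \<inter> T = {}"
  proof (rule ccontr)
    assume "f \<inter> T \<noteq> {}"
    then have "vertex_cover T E" using T by (auto simp: vertex_cover_def)
    then show False using t T by fastforce
  qed
  have fin: "finite S" "finite T" using S T by (auto simp: vertex_cover_def)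
  \<comment> \<open>\<open>T\<close> covers \<open>e\<close>, which differs from the deleted edge
    \<open>f\<close>, and misses \<open>x\<close> because \<open>x\<close> lies on \<open>f\<close>;
    so it contains the other end \<open>y\<close>. Symmetrically \<open>S\<close> contains
    \<open>z\<close>.\<close>
  have yT: "y \<in> T" using T ef \<open>f \<inter> T = {}\<close> y z by (auto simp: vertex_cover_def)
  have zS: "z \<in> S" using S ef \<open>e \<inter> S = {}\<close> y z by (auto simp: vertex_cover_def)
  define C where "C = (S \<inter> T \<inter> A) \<union> ((S \<union> T) \<inter> B)"
  define D where "D = ((S \<union> T) \<inter> A) \<union> (S \<inter> T \<inter> B)"
  have finCD: "finite C" "finite D" using fin by (auto simp: C_def D_def)
  have covS: "a \<in> S \<or> b \<in> S" if "{a, b} \<in> E" "{a, b} \<noteq> e" for a b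
  proof -
    have "{a, b} \<in> E - {e}" using that by simp
    then have "{a, b} \<inter> S \<noteq> {}" using S(1) unfolding vertex_cover_def by blast
    then show ?thesis by auto
  qed
  have covT: "a \<in> T \<or> b \<in> T" if "{a, b} \<in> E" "{a, b} \<noteq> f" for a b
  proof -
    have "{a, b} \<in> E - {f}" using that by simp
    then have "{a, b} \<inter> T \<noteq> {}" using T(1) unfolding vertex_cover_def by blast
    then show ?thesis by auto
  qed
  have "g \<inter> C \<noteq> {}" if g: "g \<in> E" for g
  proof -
    obtain a b where ab: "a \<in> A" "b \<in> B" "g = {a, b}" using E g by blast
    show ?thesis
    proof (cases "g = e \<or> g = f")
      case True
      then show ?thesis using y z yT zS by (auto simp: C_def)
    next
      case False
      then show ?thesis using covS[of a b] covT[of a b] ab g by (auto simp: C_def)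
    qed
  qed
  then have tC: "t \<le> card C" using t finCD by (simp add: vertex_cover_def)
  \<comment> \<open>\<open>D\<close> may miss \<open>e\<close> and \<open>f\<close>, and the single
    vertex \<open>x\<close> repairs both. Hence \<open>t \<le> card C\<close> and
    \<open>t \<le> card D + 1\<close>, whereas
    \<open>card C + card D \<le> card S + card T \<le> 2 * t - 2\<close>.\<close>
  have "g \<inter> insert x D \<noteq> {}" if g: "g \<in> E" for g
  proof -
    obtain a b where ab: "a \<in> A" "b \<in> B" "g = {a, b}" using E g by blast
    show ?thesis
    proof (cases "g = e \<or> g = f")
      case True
      then show ?thesis using x by auto
    next
      case False
      then show ?thesis using covS[of a b] covT[of a b] ab g by (auto simp: D_def)
    qed
  qed
  then have "t \<le> card (insert x D)" using t finCD by (simp add: vertex_cover_def)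
  then have tD: "t \<le> Suc (card D)"
    using card_insert_if[OF finCD(2), of x] by (simp split: if_splits)
  have "card C = card (S \<inter> T \<inter> A) + card ((S \<union> T) \<inter> B)"
    unfolding C_def by (rule card_Un_disjoint) (use fin AB in auto)
  moreover have "card D = card ((S \<union> T) \<inter> A) + card (S \<inter> T \<inter> B)"
    unfolding D_def by (rule card_Un_disjoint) (use fin AB in auto)
  moreover have "card (S \<inter> T \<inter> A) + card (S \<inter> T \<inter> B) \<le> card (S \<inter> T)"
    by (subst card_Un_disjoint[symmetric]) (use fin AB in \<open>auto intro!: card_mono\<close>)
  moreover have "card ((S \<union> T) \<inter> A) + card ((S \<union> T) \<inter> B) \<le> card (S \<union> T)"
    by (subst card_Un_disjoint[symmetric]) (use fin AB in \<open>auto intro!: card_mono\<close>)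
  moreover have "card (S \<union> T) + card (S \<inter> T) = card S + card T"
    using card_Un_Int[OF fin] by simp
  ultimately show False using tC tD S(2) T(2) by linarith
qed

text \<open>Take a minimum cover \<open>C\<close>. If the claim fails for \<open>E\<close>, the
  induction hypothesis for \<open>E - {e}\<close> gives a matching, necessarily with fewer than
  \<open>card C\<close> edges, and a cover of \<open>E - {e}\<close> that is no larger. So
  \<open>E\<close> is critical and its edges are disjoint; then \<open>E\<close> is itself a
  matching covered by one vertex per edge, a contradiction.\<close>

theorem konig:
  assumes "finite E" and AB: "A \<inter> B = {}" and "\<forall>e\<in>E. \<exists>a\<in>A. \<exists>b\<in>B. e = {a, b}"
  shows "\<exists>M C. M \<subseteq> E \<and> disjoint M \<and> vertex_cover C E \<and> card C \<le> card M"
  using assms(1,3)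
proof (induction E rule: finite_psubset_induct)
  case (psubset E)
  note E = psubset.prems
  have "finite e \<and> e \<noteq> {}" if "e \<in> E" for e
    using bspec[OF E that] by auto
  then have "vertex_cover (\<Union>E) E"
    using psubset.hyps unfolding vertex_cover_def by blast
  from ex_has_least_nat[of "\<lambda>C. vertex_cover C E", OF this, of card]
  obtain C where C: "vertex_cover C E" and t: "\<And>C'. vertex_cover C' E \<Longrightarrow> card C \<le> card C'"
    by auto
  show ?case
  proof (rule ccontr)
    assume no: "\<not> ?case"
    have crit: "\<exists>C'. vertex_cover C' (E - {e}) \<and> card C' < card C" if "e \<in> E" for e
    proof -
      have "E - {e} \<subset> E" "\<forall>f\<in>E - {e}. \<exists>a\<in>A. \<exists>b\<in>B. f = {a, b}"
        using that E by auto
      from psubset.IH[OF this] obtain M C'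
        where *: "M \<subseteq> E - {e}" "disjoint M" "vertex_cover C' (E - {e})" "card C' \<le> card M"
        by blast
      then have "\<not> card C \<le> card M" using no C by blast
      then show ?thesis using * by auto
    qed
    \<comment> \<open>The two sides exchanged, to treat a shared vertex in \<open>B\<close>.\<close>
    have E': "\<forall>e\<in>E. \<exists>b\<in>B. \<exists>a\<in>A. e = {b, a}"
      using E by (metis insert_commute)
    have "disjoint E"
    proof (rule disjointI, rule ccontr)
      fix e f assume ef: "e \<in> E" "f \<in> E" "e \<noteq> f" "e \<inter> f \<noteq> {}"
      then obtain x where x: "x \<in> e" "x \<in> f" by blast
      have "x \<in> A \<or> x \<in> B" using bspec[OF E ef(1)] x(1) by auto
      moreover have "B \<inter> A = {}" using AB by auto
      ultimately show False
        using critical_bipartite_no_shared_vertex[OF AB E t crit ef(1-3) _ x]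
          critical_bipartite_no_shared_vertex[OF _ E' t crit ef(1-3) _ x] by metis
    qed
    moreover have "vertex_cover ((\<lambda>e. SOME x. x \<in> e) ` E) E"
    proof -
      have "(SOME x. x \<in> e) \<in> e" if "e \<in> E" for e
        using bspec[OF E that] by (metis insertI1 someI)
      then show ?thesis using psubset.hyps by (auto simp: vertex_cover_def)
    qed
    then have "card C \<le> card E"
      using t card_image_le[OF psubset.hyps] le_trans by blast
    ultimately show False using no C by blast
  qed
qed

subsection \<open>Moving a token along an edge\<close>

text \<open>For an edge \<open>e\<close>: exactly one end carries a token, which can therefore slide
  along \<open>e\<close>. The resulting configuration is \<open>sym_diff \<sigma> e\<close>.\<close>

definition crosses :: "'v set \<Rightarrow> 'v set \<Rightarrow> bool" where
  "crosses e \<sigma> \<longleftrightarrow> card (\<sigma> \<inter> e) = 1"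

lemma crosses_pair: "u \<noteq> v \<Longrightarrow> crosses {u, v} \<sigma> \<longleftrightarrow> (u \<in> \<sigma>) \<noteq> (v \<in> \<sigma>)"
  by (auto simp: crosses_def Int_insert_right)

lemma crosses_sym_diff: "card e = 2 \<Longrightarrow> crosses e (sym_diff \<sigma> e) \<longleftrightarrow> crosses e \<sigma>"
  by (auto simp: card_2_iff crosses_pair)

lemma sym_diff_cancel: "sym_diff \<sigma> (sym_diff \<sigma> \<tau>) = \<tau>" "sym_diff (sym_diff \<tau> \<sigma>) \<sigma> = \<tau>"
  by auto

lemma finite_token_verts: "finite V \<Longrightarrow> finite (token_verts k V)"
  by (simp add: token_verts_def)

lemma token_verts_sym_diff:
  assumes "finite V" "\<sigma> \<in> token_verts k V" "e \<subseteq> V" "card e = 2" "crosses e \<sigma>"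
  shows "sym_diff \<sigma> e \<in> token_verts k V"
proof -
  have fin: "finite \<sigma>" "finite e" using assms by (auto simp: token_verts_def intro: finite_subset)
  have "card (sym_diff \<sigma> e) = card (\<sigma> - e) + card (e - \<sigma>)"
    by (rule card_Un_disjoint) (use fin in auto)
  moreover have "card \<sigma> = card (\<sigma> - e) + card (\<sigma> \<inter> e)" "card e = card (e - \<sigma>) + card (\<sigma> \<inter> e)"
    using card_Int_Diff[OF fin(1), of e] card_Int_Diff[OF fin(2), of \<sigma>] by (simp_all add: Int_commute)
  ultimately have "card (sym_diff \<sigma> e) = card \<sigma>"
    using assms by (simp add: crosses_def)
  then show ?thesis using assms by (auto simp: token_verts_def)
qed

text \<open>As \<sigma> and \<tau> have equal size, so have \<open>\<sigma> - \<tau>\<close> and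
  \<open>\<tau> - \<sigma>\<close>; each is thus a single vertex, and adjacency means sliding one
  token.\<close>

lemma crosses_sym_diff_token_verts:
  assumes "finite V" "\<sigma> \<in> token_verts k V" "\<tau> \<in> token_verts k V" "card (sym_diff \<sigma> \<tau>) = 2"
  shows "crosses (sym_diff \<sigma> \<tau>) \<sigma>"
proof -
  have fin: "finite \<sigma>" "finite \<tau>" using assms by (auto simp: token_verts_def intro: finite_subset)
  have "card (sym_diff \<sigma> \<tau>) = card (\<sigma> - \<tau>) + card (\<tau> - \<sigma>)"
    by (rule card_Un_disjoint) (use fin in auto)
  moreover have "card \<sigma> = card (\<sigma> - \<tau>) + card (\<sigma> \<inter> \<tau>)" "card \<tau> = card (\<tau> - \<sigma>) + card (\<sigma> \<inter> \<tau>)"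
    using card_Int_Diff[OF fin(1), of \<tau>] card_Int_Diff[OF fin(2), of \<sigma>] by (simp_all add: Int_commute)
  moreover have "\<sigma> \<inter> sym_diff \<sigma> \<tau> = \<sigma> - \<tau>" by auto
  ultimately show ?thesis using assms by (simp add: crosses_def token_verts_def)
qed

section \<open>Edge energies and the Laplacian form\<close>

lemma sum_crossing_sym_diff:
  fixes g :: "'v set \<Rightarrow> real"
  assumes "finite V" "e \<subseteq> V" "card e = 2"
  shows "(\<Sum>\<sigma> | \<sigma> \<in> token_verts k V \<and> crosses e \<sigma>. g (sym_diff \<sigma> e)) =
    (\<Sum>\<sigma> | \<sigma> \<in> token_verts k V \<and> crosses e \<sigma>. g \<sigma>)"
  \<comment> \<open>Sliding a token along \<open>e\<close> is an involution on the configurations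
    that cross \<open>e\<close>.\<close>
  by (rule sum.reindex_bij_witness[where i = "\<lambda>\<sigma>. sym_diff \<sigma> e" and j = "\<lambda>\<sigma>. sym_diff \<sigma> e"])
    (use token_verts_sym_diff[OF assms(1)] assms in
      \<open>simp_all add: crosses_sym_diff sym_diff_cancel\<close>)

text \<open>The share of \<open>e\<close> in the quadratic form of the token graph's Laplacian. Each
  adjacent pair is summed from both of its ends, hence the division by 2.\<close>

definition edge_energy :: "nat \<Rightarrow> 'v set \<Rightarrow> ('v set \<Rightarrow> real) \<Rightarrow> 'v set \<Rightarrow> real" where
  "edge_energy k V x e =
     (\<Sum>\<sigma> | \<sigma> \<in> token_verts k V \<and> crosses e \<sigma>. (x \<sigma> - x (sym_diff \<sigma> e))\<^sup>2) / 2"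

lemma edge_energy_alt:
  assumes "finite V" "e \<subseteq> V" "card e = 2"
  shows "edge_energy k V x e =
    (\<Sum>\<sigma> | \<sigma> \<in> token_verts k V \<and> crosses e \<sigma>. x \<sigma> * (x \<sigma> - x (sym_diff \<sigma> e)))"
proof -
  let ?S = "{\<sigma>. \<sigma> \<in> token_verts k V \<and> crosses e \<sigma>}"
  let ?g = "\<lambda>\<sigma>. x \<sigma> * (x \<sigma> - x (sym_diff \<sigma> e))"
  \<comment> \<open>The square splits into the term at \<sigma> and the same term at
    \<open>sym_diff \<sigma> e\<close>; by the involution both have the same sum.\<close>
  have "(\<Sum>\<sigma>\<in>?S. (x \<sigma> - x (sym_diff \<sigma> e))\<^sup>2) = (\<Sum>\<sigma>\<in>?S. ?g \<sigma> + ?g (sym_diff \<sigma> e))"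
    by (rule sum.cong) (simp_all add: sym_diff_cancel power2_eq_square algebra_simps)
  also have "\<dots> = 2 * (\<Sum>\<sigma>\<in>?S. ?g \<sigma>)"
    using sum_crossing_sym_diff[OF assms, where g = ?g] by (simp add: sum.distrib)
  finally show ?thesis by (simp add: edge_energy_def)
qed

text \<open>Sending \<open>e\<close> to \<open>sym_diff \<sigma> e\<close> is a bijection from the
  crossed edges to the neighbours of \<sigma>, so the degree and the off-diagonal entries both
  become sums over crossed edges.\<close>

lemma token_laplacian_apply:
  assumes G: "finite_simple_graph V E" and \<sigma>: "\<sigma> \<in> token_verts k V"
  shows "(\<Sum>\<tau>\<in>token_verts k V. laplacian_entry (token_edges k V E) \<sigma> \<tau> * x \<tau>) =
    (\<Sum>e | e \<in> E \<and> crosses e \<sigma>. x \<sigma> - x (sym_diff \<sigma> e))"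
proof -
  let ?T = "token_verts k V" and ?D = "{e \<in> E. crosses e \<sigma>}"
  define N where "N = {\<tau> \<in> ?T. sym_diff \<sigma> \<tau> \<in> E}"
  have V: "finite V" and E: "\<And>e. e \<in> E \<Longrightarrow> e \<subseteq> V \<and> card e = 2"
    using G by (auto simp: finite_simple_graph_def)
  note finT = finite_token_verts[OF V, of k]
  have bij: "bij_betw (sym_diff \<sigma>) ?D N"
    by (rule bij_betw_byWitness[where f' = "sym_diff \<sigma>"])
      (use \<sigma> E token_verts_sym_diff[OF V \<sigma>] crosses_sym_diff_token_verts[OF V \<sigma>]
        in \<open>auto simp: N_def sym_diff_cancel\<close>)
  \<comment> \<open>No configuration is adjacent to itself, so the diagonal term can be split
    off.\<close>
  have "{} \<notin> E" using E by fastforce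
  then have \<sigma>N: "\<sigma> \<notin> N" by (simp add: N_def)
  have adj: "{\<sigma>, \<tau>} \<in> token_edges k V E \<longleftrightarrow> \<tau> \<in> N" if "\<tau> \<in> ?T" for \<tau>
  proof
    assume "{\<sigma>, \<tau>} \<in> token_edges k V E"
    then obtain \<alpha> \<beta> where "{\<sigma>, \<tau>} = {\<alpha>, \<beta>}" "sym_diff \<alpha> \<beta> \<in> E"
      unfolding token_edges_def by blast
    then have "sym_diff \<sigma> \<tau> \<in> E" by (metis Un_commute doubleton_eq_iff)
    then show "\<tau> \<in> N" using that by (simp add: N_def)
  next
    assume "\<tau> \<in> N"
    then have "sym_diff \<sigma> \<tau> \<in> E" by (simp add: N_def)
    then show "{\<sigma>, \<tau>} \<in> token_edges k V E"
      using \<sigma> that unfolding token_edges_def by blast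
  qed
  have "\<exists>\<tau>\<in>N. e = {\<sigma>, \<tau>}" if e: "e \<in> token_edges k V E" "\<sigma> \<in> e" for e
  proof -
    obtain \<alpha> \<beta> where ab: "\<alpha> \<in> ?T" "\<beta> \<in> ?T" "e = {\<alpha>, \<beta>}"
      using e(1) unfolding token_edges_def by blast
    then have "\<sigma> = \<alpha> \<or> \<sigma> = \<beta>" using e(2) by simp
    then obtain \<tau> where "\<tau> \<in> ?T" "e = {\<sigma>, \<tau>}" using ab insert_commute by metis
    then show ?thesis using adj e(1) by blast
  qed
  then have "{e \<in> token_edges k V E. \<sigma> \<in> e} = (\<lambda>\<tau>. {\<sigma>, \<tau>}) ` N"
    using adj by (auto simp: N_def)
  moreover have "inj_on (\<lambda>\<tau>. {\<sigma>, \<tau>}) N" by (auto simp: inj_on_def doubleton_eq_iff)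
  ultimately have deg: "graph_degree (token_edges k V E) \<sigma> = card ?D"
    using bij_betw_same_card[OF bij] by (simp add: graph_degree_def card_image)
  have "(\<Sum>\<tau>\<in>?T. laplacian_entry (token_edges k V E) \<sigma> \<tau> * x \<tau>) =
      real (card ?D) * x \<sigma> + (\<Sum>\<tau>\<in>?T - {\<sigma>}. if \<tau> \<in> N then - x \<tau> else 0)"
    unfolding sum.remove[OF finT \<sigma>]
    by (rule arg_cong2[of _ _ _ _ "(+)"], simp add: laplacian_entry_def deg,
        rule sum.cong) (auto simp add: laplacian_entry_def adj)
  also have "(\<Sum>\<tau>\<in>?T - {\<sigma>}. if \<tau> \<in> N then - x \<tau> else 0) = (\<Sum>\<tau>\<in>N. - x \<tau>)"
    using finT \<sigma>N by (subst sum.inter_restrict[symmetric]) (auto simp: N_def intro!: sum.cong)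
  also have "\<dots> = (\<Sum>e\<in>?D. - x (sym_diff \<sigma> e))"
    by (rule sum.reindex_bij_betw[OF bij, symmetric])
  finally show ?thesis by (simp add: sum_subtractf sum_negf)
qed

subsection \<open>Bounds on the Laplacian form\<close>

text \<open>The inequality L \<le> c I of quadratic forms. In this form the bounds for disjoint edge
  sets simply add up.\<close>

definition energy_bound :: "nat \<Rightarrow> 'v set \<Rightarrow> 'v set set \<Rightarrow> real \<Rightarrow> bool" where
  "energy_bound k V E c \<longleftrightarrow>
     (\<forall>x. (\<Sum>e\<in>E. edge_energy k V x e) \<le> c * (\<Sum>\<sigma>\<in>token_verts k V. (x \<sigma>)\<^sup>2))"

lemma sum_crossing_swap:
  fixes g :: "'v set \<Rightarrow> 'v set \<Rightarrow> real"
  assumes "finite V" "finite E"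
  shows "(\<Sum>e\<in>E. \<Sum>\<sigma> | \<sigma> \<in> token_verts k V \<and> crosses e \<sigma>. g e \<sigma>) =
    (\<Sum>\<sigma>\<in>token_verts k V. \<Sum>e | e \<in> E \<and> crosses e \<sigma>. g e \<sigma>)"
  by (rule sum.swap_restrict) (use assms finite_token_verts in auto)

lemma finite_simple_graph_finite_edges: "finite_simple_graph V E \<Longrightarrow> finite E"
  unfolding finite_simple_graph_def by (metis Pow_iff finite_Pow_iff finite_subset subsetI)

lemma finite_simple_graph_subset: "finite_simple_graph V E \<Longrightarrow> F \<subseteq> E \<Longrightarrow> finite_simple_graph V F"
  by (auto simp: finite_simple_graph_def)

text \<open>On an eigenvector for \<open>l\<close> the form equals \<open>l\<close> times the
  squared norm, which is positive.\<close>

lemma largest_eigenvalue_token_le: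
  assumes G: "finite_simple_graph V E" and k: "k \<le> card V" and c: "energy_bound k V E c"
  shows "largest_eigenvalue (laplacian (token_verts k V) (token_edges k V E)) \<le> c"
proof -
  let ?T = "token_verts k V" and ?L = "laplacian (token_verts k V) (token_edges k V E)"
  have V: "finite V" and E: "\<And>e. e \<in> E \<Longrightarrow> e \<subseteq> V \<and> card e = 2"
    using G by (auto simp: finite_simple_graph_def)
  note finT = finite_token_verts[OF V, of k]
  \<comment> \<open>With at least one configuration the spectrum is nonempty, so its
    \<open>Max\<close> is a genuine eigenvalue.\<close>
  have "?T \<noteq> {}" using obtain_subset_with_card_n[OF k] by (auto simp: token_verts_def)
  moreover have "l \<le> c" if ev: "eigenvalue ?L l" for l
  proof -
    obtain x where x: "\<exists>\<sigma>\<in>?T. x \<sigma> \<noteq> 0"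
      "\<And>\<sigma>. \<sigma> \<in> ?T \<Longrightarrow> (\<Sum>\<tau>\<in>?T. laplacian_entry (token_edges k V E) \<sigma> \<tau> * x \<tau>) = l * x \<sigma>"
      using iffD1[OF eigenvalue_laplacian_iff[OF finT] ev] by blast
    let ?N = "\<Sum>\<sigma>\<in>?T. (x \<sigma>)\<^sup>2"
    have "l * ?N = (\<Sum>\<sigma>\<in>?T. x \<sigma> * (l * x \<sigma>))"
      by (simp add: sum_distrib_left power2_eq_square algebra_simps)
    also have "\<dots> = (\<Sum>\<sigma>\<in>?T. \<Sum>e | e \<in> E \<and> crosses e \<sigma>. x \<sigma> * (x \<sigma> - x (sym_diff \<sigma> e)))"
      by (rule sum.cong) (simp_all add: x(2)[symmetric] token_laplacian_apply[OF G] sum_distrib_left)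
    also have "\<dots> = (\<Sum>e\<in>E. edge_energy k V x e)"
      unfolding sum_crossing_swap[OF V finite_simple_graph_finite_edges[OF G], symmetric]
      by (rule sum.cong) (use E in \<open>simp_all add: edge_energy_alt[OF V]\<close>)
    also have "\<dots> \<le> c * ?N" using c by (simp add: energy_bound_def)
    finally have "l * ?N \<le> c * ?N" .
    moreover obtain \<sigma> where \<sigma>: "\<sigma> \<in> ?T" "x \<sigma> \<noteq> 0" using x(1) by blast
    then have "?N > 0" by (intro sum_pos2[OF finT \<sigma>(1)]) auto
    ultimately show ?thesis by simp
  qed
  ultimately show ?thesis
    unfolding largest_eigenvalue_def
    using finite_spectrum_laplacian spectrum_laplacian_nonempty[OF finT]
    by (subst Max_le_iff) (auto simp: spectrum_def)
qed

lemma energy_bound_mono: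
  assumes "energy_bound k V E a" "a \<le> b"
  shows "energy_bound k V E b"
  unfolding energy_bound_def
proof
  fix x :: "'a set \<Rightarrow> real"
  have "a * (\<Sum>\<sigma>\<in>token_verts k V. (x \<sigma>)\<^sup>2) \<le> b * (\<Sum>\<sigma>\<in>token_verts k V. (x \<sigma>)\<^sup>2)"
    using assms(2) by (intro mult_right_mono sum_nonneg) auto
  then show "(\<Sum>e\<in>E. edge_energy k V x e) \<le> b * (\<Sum>\<sigma>\<in>token_verts k V. (x \<sigma>)\<^sup>2)"
    using assms(1) order_trans unfolding energy_bound_def by blast
qed

lemma energy_bound_union:
  assumes "energy_bound k V E a" "energy_bound k V F b" "finite E" "finite F" "E \<inter> F = {}"
  shows "energy_bound k V (E \<union> F) (a + b)"
  using assms by (auto simp: energy_bound_def sum.union_disjoint distrib_right intro!: add_mono)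

section \<open>The Anderson--Morley bound\<close>

lemma square_diff_le_weighted:
  fixes x y p q :: real
  assumes "p > 0" "q > 0" "p + q \<le> c"
  shows "(x - y)\<^sup>2 \<le> c * (x\<^sup>2 / p) + c * (y\<^sup>2 / q)"
proof -
  \<comment> \<open>Weighted Cauchy--Schwarz, with the defect written as an explicit square.\<close>
  have "(x - y)\<^sup>2 * (p * q) + (q * x + p * y)\<^sup>2 = (p + q) * (q * x\<^sup>2 + p * y\<^sup>2)"
    by (simp add: power2_eq_square algebra_simps)
  then have "(x - y)\<^sup>2 * (p * q) \<le> (p + q) * (q * x\<^sup>2 + p * y\<^sup>2)"
    using zero_le_power2[of "q * x + p * y"] by linarith
  then have "(x - y)\<^sup>2 \<le> (p + q) * (x\<^sup>2 / p + y\<^sup>2 / q)"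
    using assms by (simp add: field_simps)
  also have "\<dots> \<le> c * (x\<^sup>2 / p + y\<^sup>2 / q)"
    using assms by (intro mult_right_mono) auto
  finally show ?thesis by (simp add: distrib_left)
qed

text \<open>An edge of the token graph charges each of its ends \<sigma> the amount
  \<open>c * (x \<sigma>)\<^sup>2 / d \<sigma>\<close>, where \<open>d \<sigma>\<close> is the
  degree. Since \<sigma> is charged \<open>d \<sigma>\<close> times, it pays at most
  \<open>c * (x \<sigma>)\<^sup>2\<close> in total.\<close>

lemma energy_bound_degree_sum:
  assumes G: "finite_simple_graph V E"
    and c: "\<And>\<sigma> e. \<sigma> \<in> token_verts k V \<Longrightarrow> e \<in> E \<Longrightarrow> crosses e \<sigma> \<Longrightarrow>
      card {f \<in> E. crosses f \<sigma>} + card {f \<in> E. crosses f (sym_diff \<sigma> e)} \<le> c"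
  shows "energy_bound k V E (real c)"
  unfolding energy_bound_def
proof
  fix x :: "'a set \<Rightarrow> real"
  let ?T = "token_verts k V"
  define d where "d \<sigma> = real (card {f \<in> E. crosses f \<sigma>})" for \<sigma>
  have V: "finite V" and E: "\<And>e. e \<in> E \<Longrightarrow> e \<subseteq> V \<and> card e = 2"
    using G by (auto simp: finite_simple_graph_def)
  note finE = finite_simple_graph_finite_edges[OF G]
  have pos: "d \<sigma> > 0" if "e \<in> E" "crosses e \<sigma>" for e \<sigma>
    using that finE by (auto simp: d_def card_gt_0_iff)
  let ?g = "\<lambda>\<sigma>. real c * ((x \<sigma>)\<^sup>2 / d \<sigma>)"
  have "edge_energy k V x e \<le> (\<Sum>\<sigma> | \<sigma> \<in> ?T \<and> crosses e \<sigma>. ?g \<sigma>)" if e: "e \<in> E" for e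
  proof -
    have "(\<Sum>\<sigma> | \<sigma> \<in> ?T \<and> crosses e \<sigma>. (x \<sigma> - x (sym_diff \<sigma> e))\<^sup>2) \<le>
      (\<Sum>\<sigma> | \<sigma> \<in> ?T \<and> crosses e \<sigma>. ?g \<sigma> + ?g (sym_diff \<sigma> e))"
    proof (rule sum_mono)
      fix \<sigma> assume "\<sigma> \<in> {\<sigma>. \<sigma> \<in> ?T \<and> crosses e \<sigma>}"
      then have \<sigma>: "\<sigma> \<in> ?T" "crosses e \<sigma>" by auto
      have "crosses e (sym_diff \<sigma> e)" using \<sigma> E[OF e] by (simp add: crosses_sym_diff)
      moreover have "d \<sigma> + d (sym_diff \<sigma> e) \<le> real c"
        using c[OF \<sigma>(1) e \<sigma>(2)] unfolding d_def by linarith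
      ultimately show "(x \<sigma> - x (sym_diff \<sigma> e))\<^sup>2 \<le> ?g \<sigma> + ?g (sym_diff \<sigma> e)"
        using pos e \<sigma> by (intro square_diff_le_weighted) auto
    qed
    \<comment> \<open>This factor 2 cancels the halving in \<open>edge_energy\<close>.\<close>
    also have "\<dots> = 2 * (\<Sum>\<sigma> | \<sigma> \<in> ?T \<and> crosses e \<sigma>. ?g \<sigma>)"
      using sum_crossing_sym_diff[OF V, of e ?g k] E[OF e] by (simp only: sum.distrib)
    finally show ?thesis by (simp add: edge_energy_def)
  qed
  then have "(\<Sum>e\<in>E. edge_energy k V x e) \<le> (\<Sum>e\<in>E. \<Sum>\<sigma> | \<sigma> \<in> ?T \<and> crosses e \<sigma>. ?g \<sigma>)"
    by (rule sum_mono)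
  also have "\<dots> = (\<Sum>\<sigma>\<in>?T. d \<sigma> * ?g \<sigma>)"
    unfolding sum_crossing_swap[OF V finE] by (simp add: d_def)
  \<comment> \<open>Equality holds termwise unless \<open>d \<sigma> = 0\<close>, when the left term
    is 0.\<close>
  also have "\<dots> \<le> (\<Sum>\<sigma>\<in>?T. real c * (x \<sigma>)\<^sup>2)"
    by (rule sum_mono) (auto simp: d_def)
  finally show "(\<Sum>e\<in>E. edge_energy k V x e) \<le> real c * (\<Sum>\<sigma>\<in>?T. (x \<sigma>)\<^sup>2)"
    by (simp add: sum_distrib_left)
qed

section \<open>Stars and matchings\<close>

lemma energy_bound_star:
  assumes G: "finite_simple_graph V E" and v: "\<And>e. e \<in> E \<Longrightarrow> v \<in> e"
  shows "energy_bound k V E (real (card E) + 1)"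
proof -
  have "energy_bound k V E (real (card E + 1))"
  proof (rule energy_bound_degree_sum[OF G])
    fix \<sigma> e assume e: "e \<in> E" "crosses e \<sigma>"
    let ?A = "{f \<in> E. crosses f \<sigma>}" and ?B = "{f \<in> E. crosses f (sym_diff \<sigma> e)}"
    have pair: "\<exists>w. f = {v, w} \<and> v \<noteq> w" if "f \<in> E" for f
      using G v[OF that] that by (fastforce simp: finite_simple_graph_def card_2_iff)
    obtain w where w: "e = {v, w}" "v \<noteq> w" using pair e by blast
    \<comment> \<open>Sliding along \<open>e\<close> changes the occupation of the centre
      \<open>v\<close> and of \<open>w\<close> only, so a star edge other than \<open>e\<close>
      cannot be crossed both before and after.\<close>
    have "f = e" if f: "f \<in> ?A \<inter> ?B" for f
    proof -
      obtain u where u: "f = {v, u}" "v \<noteq> u" using pair f by blast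
      then show ?thesis using f w by (auto simp: crosses_pair)
    qed
    then have "card (?A \<inter> ?B) \<le> 1"
      using card_mono[of "{e}" "?A \<inter> ?B"] by auto
    moreover have finE: "finite E" by (rule finite_simple_graph_finite_edges[OF G])
    then have "card (?A \<union> ?B) \<le> card E" by (intro card_mono) auto
    moreover have "card ?A + card ?B = card (?A \<union> ?B) + card (?A \<inter> ?B)"
      using finE by (intro card_Un_Int) auto
    ultimately show "card ?A + card ?B \<le> card E + 1" by linarith
  qed
  then show ?thesis by (simp add: add.commute)
qed

text \<open>Each crossed edge contains a token, and disjoint edges contain different tokens.\<close>

lemma card_crossing_matching_le:
  assumes "disjoint M" "finite \<sigma>"
  shows "card {e \<in> M. crosses e \<sigma>} \<le> card \<sigma>"
proof -
  define h where "h e = (SOME v. v \<in> \<sigma> \<inter> e)" for e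
  have h: "h e \<in> \<sigma> \<inter> e" if "crosses e \<sigma>" for e
  proof -
    have "\<sigma> \<inter> e \<noteq> {}" using that by (auto simp: crosses_def)
    then have "\<exists>v. v \<in> \<sigma> \<inter> e" by blast
    then show ?thesis unfolding h_def by (rule someI_ex)
  qed
  have "inj_on h {e \<in> M. crosses e \<sigma>}"
  proof (rule inj_onI)
    fix e f assume ef: "e \<in> {e \<in> M. crosses e \<sigma>}" "f \<in> {e \<in> M. crosses e \<sigma>}" "h e = h f"
    then have "h e \<in> e \<inter> f" using h[of e] h[of f] by auto
    then show "e = f" using ef disjointD[OF assms(1), of e f] by auto
  qed
  then show ?thesis using h assms(2) by (intro card_inj_on_le) auto
qed

lemma energy_bound_matching:
  assumes G: "finite_simple_graph V M" and M: "disjoint M"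
  shows "energy_bound k V M (2 * real k)"
proof -
  have V: "finite V" and E: "\<And>e. e \<in> M \<Longrightarrow> e \<subseteq> V \<and> card e = 2"
    using G by (auto simp: finite_simple_graph_def)
  have le: "card {e \<in> M. crosses e \<sigma>} \<le> k" if "\<sigma> \<in> token_verts k V" for \<sigma>
  proof -
    have "\<sigma> \<subseteq> V" "card \<sigma> = k" using that by (auto simp: token_verts_def)
    then show ?thesis using card_crossing_matching_le[OF M finite_subset[OF _ V]] by metis
  qed
  have "energy_bound k V M (real (2 * k))"
  proof (rule energy_bound_degree_sum[OF G])
    fix \<sigma> e assume *: "\<sigma> \<in> token_verts k V" "e \<in> M" "crosses e \<sigma>"
    have "sym_diff \<sigma> e \<in> token_verts k V"
      using token_verts_sym_diff[OF V] * E by blast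
    from add_mono[OF le[OF *(1)] le[OF this]]
    show "card {f \<in> M. crosses f \<sigma>} + card {f \<in> M. crosses f (sym_diff \<sigma> e)} \<le> 2 * k"
      by simp
  qed
  then show ?thesis by simp
qed

section \<open>Assembling the bound from stars and matchings\<close>

lemma energy_bound_vertex_cover:
  assumes "finite C" "finite_simple_graph V E" "\<And>e. e \<in> E \<Longrightarrow> e \<inter> C \<noteq> {}"
  shows "energy_bound k V E (real (card E) + real (card C))"
  using assms
proof (induction C arbitrary: E rule: finite_induct)
  case empty
  then have "E = {}" by blast
  then show ?case by (simp add: energy_bound_def)
next
  case (insert v C)
  let ?S = "{e \<in> E. v \<in> e}"
  have finE: "finite E" by (rule finite_simple_graph_finite_edges[OF insert.prems(1)])
  \<comment> \<open>The star at \<open>v\<close> takes every edge through \<open>v\<close>, even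
    those that \<open>C\<close> also meets. The remaining edges avoid \<open>v\<close>, so
    \<open>C\<close> covers them, and the extra 1 of the star pays for the cover vertex
    \<open>v\<close>.\<close>
  have "energy_bound k V ?S (real (card ?S) + 1)"
    by (rule energy_bound_star) (use insert.prems finite_simple_graph_subset[of V E ?S] in auto)
  moreover have "energy_bound k V (E - ?S) (real (card (E - ?S)) + real (card C))"
    by (rule insert.IH) (use insert.prems finite_simple_graph_subset[of V E "E - ?S"] in auto)
  ultimately have "energy_bound k V (?S \<union> (E - ?S))
      (real (card ?S) + 1 + (real (card (E - ?S)) + real (card C)))"
    by (rule energy_bound_union) (use finE in auto)
  moreover have "?S \<union> (E - ?S) = E" by auto
  moreover have "card E = card ?S + card (E - ?S)"
    using finE by (metis (no_types, lifting) card_Int_Diff Int_absorb1 mem_Collect_eq subsetI)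
  ultimately show ?case using insert.hyps by (simp add: algebra_simps)
qed

text \<open>\<open>r\<close> is the ratio of cover to matching size: 2 in general, 1 for bipartite
  graphs. The hypothesis ranges over all subsets of \<open>E\<close> because the induction deletes
  matchings.\<close>

lemma energy_bound_from_matching_number:
  assumes "finite_simple_graph V E" "k \<ge> 1"
    and "\<And>F. F \<subseteq> E \<Longrightarrow> \<exists>M C. M \<subseteq> F \<and> disjoint M \<and> vertex_cover C F \<and> card C \<le> r * card M"
  shows "energy_bound k V E (real (card E) + real r * (2 * real k - 1))"
proof -
  have "finite E" by (rule finite_simple_graph_finite_edges[OF assms(1)])
  then show ?thesis using assms(1,3)
  proof (induction E rule: finite_psubset_induct)
    case (psubset E)
    obtain M C where MC: "M \<subseteq> E" "disjoint M" "vertex_cover C E" "card C \<le> r * card M"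
      using psubset.prems(2)[of E] by blast
    show ?case
    proof (cases "card M \<ge> 2 * k")
      case True
      have finM: "finite M" using MC psubset.hyps finite_subset by blast
      \<comment> \<open>Because \<open>k \<ge> 1\<close>, the removed matching is nonempty and the
        edge set shrinks strictly.\<close>
      have "M \<noteq> {}" using True \<open>k \<ge> 1\<close> by auto
      then have "E - M \<subset> E" using MC by blast
      then have "energy_bound k V (E - M) (real (card (E - M)) + real r * (2 * real k - 1))"
        using psubset.prems finite_simple_graph_subset[of V E "E - M"]
        by (intro psubset.IH) auto
      moreover have "energy_bound k V M (2 * real k)"
        using energy_bound_matching finite_simple_graph_subset psubset.prems(1) MC by blast
      ultimately have "energy_bound k V ((E - M) \<union> M)
          (real (card (E - M)) + real r * (2 * real k - 1) + 2 * real k)"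
        by (rule energy_bound_union) (use psubset.hyps finM in auto)
      moreover have "(E - M) \<union> M = E" using MC by blast
      \<comment> \<open>The cost \<open>2 * k\<close> of the matching is paid by its at least
        \<open>2 * k\<close> edges.\<close>
      moreover have "real (card (E - M)) + 2 * real k \<le> real (card E)"
        using card_Diff_subset[OF finM MC(1)] card_mono[OF psubset.hyps MC(1)] True by linarith
      ultimately show ?thesis
        by (auto intro: energy_bound_mono)
    next
      case False
      have "energy_bound k V E (real (card E) + real (card C))"
        by (rule energy_bound_vertex_cover) (use MC(3) psubset.prems(1) in \<open>auto simp: vertex_cover_def\<close>)
      \<comment> \<open>Here \<open>card M\<close> is at most \<open>2 * k - 1\<close>, the source
        of the subtracted 1.\<close>
      moreover have "real (card C) \<le> real r * (2 * real k - 1)"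
      proof -
        have "real (card C) \<le> real r * real (card M)"
          using MC(4) by (metis of_nat_le_iff of_nat_mult)
        also have "\<dots> \<le> real r * (2 * real k - 1)"
          using False by (intro mult_left_mono) auto
        finally show ?thesis .
      qed
      ultimately show ?thesis
        by (auto intro: energy_bound_mono)
    qed
  qed
qed

theorem theorem1p7:
  fixes V :: "'v set" and E :: "'v set set" and k :: nat
  assumes "finite_simple_graph V E"
    and "1 \<le> k" and "real k \<le> real (card V) / 2"
  shows "largest_eigenvalue (laplacian (token_verts k V) (token_edges k V E))
           \<le> real (card E) + 4 * real k - 2
       \<and> (bipartite_graph V E \<longrightarrow>
           largest_eigenvalue (laplacian (token_verts k V) (token_edges k V E))
             \<le> real (card E) + 2 * real k - 1)"
proof (intro conjI impI)
  have k: "k \<le> card V" using assms(3) by linarith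
  have finE: "finite E" by (rule finite_simple_graph_finite_edges[OF assms(1)])
  \<comment> \<open>Ratio 2 gives the excess 2 (2k - 1) = 4k - 2.\<close>
  have "\<exists>M C. M \<subseteq> F \<and> disjoint M \<and> vertex_cover C F \<and> card C \<le> 2 * card M" if "F \<subseteq> E" for F
  proof -
    have F: "finite F" "\<And>e. e \<in> F \<Longrightarrow> card e = 2"
      using that finE assms(1) finite_subset by (auto simp: finite_simple_graph_def)
    show ?thesis using matching_with_small_vertex_cover[OF F] by metis
  qed
  from energy_bound_from_matching_number[OF assms(1,2) this]
  show "largest_eigenvalue (laplacian (token_verts k V) (token_edges k V E))
      \<le> real (card E) + 4 * real k - 2"
    by (intro largest_eigenvalue_token_le[OF assms(1) k]) (simp add: algebra_simps)
  assume "bipartite_graph V E"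
  then obtain A B where AB: "A \<inter> B = {}" "\<forall>e\<in>E. \<exists>a\<in>A. \<exists>b\<in>B. e = {a, b}"
    by (auto simp: bipartite_graph_def)
  \<comment> \<open>Subsets of \<open>E\<close> inherit the bipartition, so Koenig's theorem yields
    ratio 1 and the excess 2k - 1.\<close>
  have "\<exists>M C. M \<subseteq> F \<and> disjoint M \<and> vertex_cover C F \<and> card C \<le> 1 * card M" if "F \<subseteq> E" for F
    using konig[of F A B] AB that finE finite_subset by (metis nat_mult_1 subsetD)
  from energy_bound_from_matching_number[OF assms(1,2) this]
  show "largest_eigenvalue (laplacian (token_verts k V) (token_edges k V E))
      \<le> real (card E) + 2 * real k - 1"
    by (intro largest_eigenvalue_token_le[OF assms(1) k]) (simp add: algebra_simps)
qed

end
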